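(* Let $$G(p,q,z)=\sum_{n\ge 0}\ \sum_{k=0}^{n}\ \sum_{\pi\in A_{n,k}(213)}p^{\mathrm{des}(\pi)}q^kz^n .$$ Then $$G(p,q,z)=\frac{1-pqz-(1-z)q+(zq-pqz-q)\widetilde{F}_0}{1-z-pqz-(1-z)q},$$ where $$\widetilde{F}_0=\frac{1-zq(1+p)-\sqrt{(1+zq(1-p))^2-4zq}}{2pqz}.$$
   Context: $S_n$ is the set of permutations $\pi=\pi_1\cdots\pi_n$ of $\{1,\ldots,n\}$; for $n=0$ there is only the empty permutation, with $\mathrm{des}=0$, which contributes the term $1$ to $G$. $\mathrm{maxdrop}(\pi)=\max\{i-\pi_i : 1\le i\le n\}$ and $A(n,k)=\{\pi\in S_n:\mathrm{maxdrop}(\pi)\le k\}$ (vacuous condition for $n=0$). $A_{n,k}(213)$ is the set of permutations in $A(n,k)$ that avoid the pattern $213$, i.e. have no indices $a<b<c$ with $\pi_b<\pi_a<\pi_c$. $\mathrm{des}(\pi)$ is the number of $i$ with $1\le i\le n-1$ and $\pi_i>\pi_{i+1}$. The identity is one of formal power series; the square root is the power series with constant term $1$. *)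

theory Defs
  imports
    "HOL-Combinatorics.Permutations"
    "HOL-Computational_Algebra.Formal_Power_Series"
    "HOL-Computational_Algebra.Polynomial_Factorial"
begin

text \<open>A permutation \<open>\<pi>\<close> in $S_n$ is a function with \<open>\<pi> permutes {1..n}\<close>; its one-line notation is
  \<open>\<pi> 1, \<dots>, \<pi> n\<close>, and it is the identity outside \<open>{1..n}\<close>, so that each element of $S_n$ is
  represented by exactly one function.\<close>

definition des :: "nat \<Rightarrow> (nat \<Rightarrow> nat) \<Rightarrow> nat" where
  "des n \<pi> = card {i. 1 \<le> i \<and> i < n \<and> \<pi> i > \<pi> (i + 1)}"

text \<open>The differences are taken in the integers; \<open>maxdrop\<close> is only meaningful for \<open>n > 0\<close>.\<close>

definition maxdrop :: "nat \<Rightarrow> (nat \<Rightarrow> nat) \<Rightarrow> int" where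
  "maxdrop n \<pi> = Max {int i - int (\<pi> i) |i. 1 \<le> i \<and> i \<le> n}"

definition A :: "nat \<Rightarrow> nat \<Rightarrow> (nat \<Rightarrow> nat) set" where
  "A n k = {\<pi>. \<pi> permutes {1..n} \<and> (n = 0 \<or> maxdrop n \<pi> \<le> int k)}"

definition avoids213 :: "nat \<Rightarrow> (nat \<Rightarrow> nat) \<Rightarrow> bool" where
  "avoids213 n \<pi> \<longleftrightarrow>
     \<not> (\<exists>a b c. 1 \<le> a \<and> a < b \<and> b < c \<and> c \<le> n \<and> \<pi> b < \<pi> a \<and> \<pi> a < \<pi> c)"

definition A213 :: "nat \<Rightarrow> nat \<Rightarrow> (nat \<Rightarrow> nat) set" where
  "A213 n k = {\<pi> \<in> A n k. avoids213 n \<pi>}"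

text \<open>The ring of formal power series in \<open>p\<close>, \<open>q\<close>, \<open>z\<close> over the rationals is represented by
  iterated univariate power series: the outermost variable is \<open>z\<close>, then \<open>q\<close>, and the innermost
  is \<open>p\<close>.\<close>

type_synonym series = "rat fps fps fps"

definition pvar :: series where "pvar = fps_const (fps_const fps_X)"
definition qvar :: series where "qvar = fps_const fps_X"
definition zvar :: series where "zvar = fps_X"

text \<open>The coefficient of \<open>z ^ n\<close> is a polynomial in \<open>p\<close> (here \<open>fps_const fps_X\<close>) and \<open>q\<close>
  (here \<open>fps_X\<close>).\<close>

definition G :: series where
  "G = Abs_fps (\<lambda>n. \<Sum>k=0..n. \<Sum>\<pi>\<in>A213 n k. fps_const fps_X ^ des n \<pi> * fps_X ^ k)"

text \<open>The square root whose constant term, in all three variables, is 1.\<close>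

definition sqrt_series :: "series \<Rightarrow> series" where
  "sqrt_series f = (THE s. s\<^sup>2 = f \<and> fps_nth (fps_nth (fps_nth s 0) 0) 0 = 1)"

text \<open>The argument of \<open>sqrt_series\<close> below is 1 at \<open>z = 0\<close>; this is enough to make the root exist
  and be unique.\<close>

lemma sqrt_series_ex1:
  fixes f :: series
  assumes "fps_nth f 0 = 1"
  shows "\<exists>!s. s\<^sup>2 = f \<and> fps_nth (fps_nth (fps_nth s 0) 0) 0 = 1"
proof (rule ex_ex1I)
  define h :: "rat fps fps" where "h = fps_const (fps_const (1/2))"
  have h: "2 * h = 1"
  proof -
    have "2 * h = h + h" by (rule mult_2)
    also have "\<dots> = fps_const (fps_const (1/2 + 1/2))" unfolding h_def by (simp only: fps_const_add)
    also have "\<dots> = 1" by (simp only: field_sum_of_halves fps_const_1_eq_1)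
    finally show ?thesis .
  qed
  define c where "c = (\<lambda>c n. if n = 0 then 1 else
    h * (fps_nth f n - (\<Sum>i\<in>{1..<n}. c i * c (n - i))) :: rat fps fps)"
  define g where "g = wfrec less_than c"
  have adm: "adm_wf less_than c"
    unfolding adm_wf_def c_def by (auto intro!: arg_cong2[of _ _ _ _ "(*)"] sum.cong)
  have g: "g n = c g n" for n
    unfolding g_def by (rule wfrec_fixpoint[OF wf_less_than adm, THEN fun_cong])
  have g0: "g 0 = 1" by (simp add: g c_def)
  have "(Abs_fps g)\<^sup>2 = f"
  proof (rule fps_ext)
    fix n
    show "fps_nth ((Abs_fps g)\<^sup>2) n = fps_nth f n"
    proof (cases "n = 0")
      case True
      then show ?thesis using assms by (simp add: g0 power2_eq_square)
    next
      case False
      have "fps_nth ((Abs_fps g)\<^sup>2) n = (\<Sum>i=0..n. g i * g (n - i))"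
        by (simp add: power2_eq_square fps_mult_nth)
      also have "{0..n} = insert 0 (insert n {1..<n})" using False by auto
      also have "(\<Sum>i\<in>\<dots>. g i * g (n - i)) = 2 * g n + (\<Sum>i\<in>{1..<n}. g i * g (n - i))"
        using False by (simp add: g0)
      also have "2 * g n = (2 * h) * (fps_nth f n - (\<Sum>i\<in>{1..<n}. g i * g (n - i)))"
        using False by (subst g) (simp add: c_def mult.assoc)
      finally show ?thesis by (simp add: h)
    qed
  qed
  then show "\<exists>s. s\<^sup>2 = f \<and> fps_nth (fps_nth (fps_nth s 0) 0) 0 = 1"
    by (intro exI[of _ "Abs_fps g"]) (simp add: g0)
next
  fix s t :: series
  assume s: "s\<^sup>2 = f \<and> fps_nth (fps_nth (fps_nth s 0) 0) 0 = 1"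
    and t: "t\<^sup>2 = f \<and> fps_nth (fps_nth (fps_nth t 0) 0) 0 = 1"
  have "(s - t) * (s + t) = s\<^sup>2 - t\<^sup>2" by (simp add: power2_eq_square algebra_simps)
  also have "\<dots> = 0" using s t by simp
  finally have "s - t = 0 \<or> s + t = 0" by (simp only: mult_eq_0_iff)
  moreover have "s + t \<noteq> 0"
  proof
    assume "s + t = 0"
    then have "fps_nth (fps_nth (fps_nth (s + t) 0) 0) 0 = 0" by simp
    then show False unfolding fps_add_nth using s t by simp
  qed
  ultimately show "s = t" by simp
qed

text \<open>The quotients live in the field of fractions of the ring of power series, into which that
  ring embeds by \<open>to_fract\<close>; all denominators involved are nonzero power series.\<close>

definition F0 :: "series fract" where
  "F0 = (let p = to_fract pvar; q = to_fract qvar; z = to_fract zvar;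
             r = to_fract (sqrt_series ((1 + zvar * qvar * (1 - pvar))\<^sup>2 - 4 * zvar * qvar))
         in (1 - z * q * (1 + p) - r) / (2 * p * q * z))"

end

theory Submission
  imports Defs
begin

text \<open>A 213-avoiding permutation splits around its entry 1 as \<open>L 1 R\<close> with every entry of \<open>L\<close>
  above every entry of \<open>R\<close>. If \<open>L\<close> has length \<open>l\<close>, the entry 1 drops by \<open>l\<close>, the drops of \<open>R\<close>
  grow by \<open>l\<close>, and those of \<open>L\<close> stay below \<open>l\<close>; hence \<open>maxdrop \<le> k\<close> means \<open>l \<le> k\<close> and
  \<open>maxdrop R \<le> k - l\<close>, with no condition on \<open>L\<close>. With \<open>C\<close> the generating function of all
  213-avoiding permutations at \<open>q z\<close> and \<open>N = 1 + p (C - 1)\<close>, this gives \<open>C = 1 + q z N C\<close>,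
  a quadratic equation solved by \<open>C - 1 = F0\<close>, and \<open>G = C + z N G\<close>.\<close>

section \<open>Splitting a 213-avoiding permutation at its minimum\<close>

text \<open>A maximum is bounded iff every element is. Writing the drop as a sum avoids truncated
  subtraction, and at n = 0 the bounded quantifier is vacuous, so the meaningless \<open>Max\<close>
  of the empty set never reappears.\<close>

lemma mem_A_iff:
  "\<pi> \<in> A n k \<longleftrightarrow> \<pi> permutes {1..n} \<and> (\<forall>i\<in>{1..n}. i \<le> \<pi> i + k)"
proof (cases "n = 0")
  case True
  then show ?thesis by (simp add: A_def)
next
  case False
  define D where "D = (\<lambda>i. int i - int (\<pi> i)) ` {1..n}"
  have D: "{int i - int (\<pi> i) |i. 1 \<le> i \<and> i \<le> n} = D"
    by (auto simp: D_def)
  have "finite D" "D \<noteq> {}" using False by (auto simp: D_def)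
  then have "maxdrop n \<pi> \<le> int k \<longleftrightarrow> (\<forall>d\<in>D. d \<le> int k)"
    unfolding maxdrop_def D by (rule Max_le_iff)
  also have "\<dots> \<longleftrightarrow> (\<forall>i\<in>{1..n}. i \<le> \<pi> i + k)"
    unfolding D_def ball_simps by (intro ball_cong refl) linarith
  finally show ?thesis using False by (simp add: A_def)
qed

lemma finite_A213: "finite (A213 n k)"
  by (rule finite_subset[of _ "{\<pi>. \<pi> permutes {1..n}}"])
    (auto simp: A213_def A_def finite_permutations)

text \<open>Since i \<le> n \<le> k, the drop condition is void. Hence \<open>A n n\<close> stands
  for all of S_n, and \<open>A213 l l\<close> below for all 213-avoiders of length l.\<close>

lemma A_eq_of_le:
  assumes "n \<le> k"
  shows "A n k = A n n"
  using assms by (auto simp: mem_A_iff)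

lemma A213_0: "A213 0 k = {id}"
  by (auto simp: A213_def A_def avoids213_def)

lemma permutesI_inj_on:
  assumes "finite S" "inj_on f S" "\<And>x. x \<in> S \<Longrightarrow> f x \<in> S" "\<And>x. x \<notin> S \<Longrightarrow> f x = x"
  shows "f permutes S"
proof (rule bij_imp_permutes)
  have "f ` S = S" by (rule endo_inj_surj) (use assms in auto)
  then show "bij_betw f S S" using assms(2) by (simp add: bij_betw_def)
qed (use assms in auto)

section \<open>Gluing two blocks around the entry 1\<close>

text \<open>The word L 1 R, where \<open>f\<close> and \<open>g\<close> are the standardized
  patterns of L (length l) and R (length m). It is the identity at 0 and beyond the last position,
  as \<open>permutes\<close> demands.\<close>

definition glue :: "nat \<Rightarrow> nat \<Rightarrow> (nat \<Rightarrow> nat) \<Rightarrow> (nat \<Rightarrow> nat) \<Rightarrow> nat \<Rightarrow> nat" where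
  "glue l m f g i =
    (if i = 0 then 0 else if i \<le> l then f i + Suc m else if i = Suc l then 1
     else if i \<le> Suc (l + m) then Suc (g (i - Suc l)) else i)"

lemma glue_simps:
  "\<lbrakk>1 \<le> i; i \<le> l\<rbrakk> \<Longrightarrow> glue l m f g i = f i + Suc m"
  "glue l m f g (Suc l) = 1"
  "\<lbrakk>1 \<le> i; i \<le> m\<rbrakk> \<Longrightarrow> glue l m f g (Suc (l + i)) = Suc (g i)"
  "i = 0 \<or> i > Suc (l + m) \<Longrightarrow> glue l m f g i = i"
  by (auto simp: glue_def)

lemma index_cases [consumes 2]:
  fixes i l m :: nat
  assumes "1 \<le> i" "i \<le> Suc (l + m)"
  obtains (left) "i \<le> l" | (min) "i = Suc l" | (right) j where "1 \<le> j" "j \<le> m" "i = Suc (l + j)"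
proof -
  consider "i \<le> l" | "i = Suc l" | "i > Suc l" by linarith
  then show thesis
  proof cases
    case 3
    then show thesis using right[of "i - Suc l"] assms by auto
  qed (use that in auto)
qed

lemma permutes_range:
  assumes "f permutes {1..n}" "1 \<le> i" "i \<le> n"
  shows "1 \<le> f i" "f i \<le> n"
  using permutes_in_image[OF assms(1), of i] assms(2,3) by auto

lemma permutes_glue:
  assumes f: "f permutes {1..l}" and g: "g permutes {1..m}"
  shows "glue l m f g permutes {1..Suc (l + m)}"
proof (rule permutesI_inj_on)
  note fr = permutes_range[OF f] and gr = permutes_range[OF g]
  have fi: "f i = f j \<longleftrightarrow> i = j" for i j using permutes_inj[OF f] by (simp add: inj_eq)
  have gi: "g i = g j \<longleftrightarrow> i = j" for i j using permutes_inj[OF g] by (simp add: inj_eq)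
  let ?h = "glue l m f g"
  \<comment> \<open>The value alone reveals the block of its position, so equal values come from the
    same block and injectivity reduces to that of \<open>f\<close> or \<open>g\<close>.\<close>
  have pos: "(i \<le> l \<longleftrightarrow> Suc m < ?h i) \<and> (i = Suc l \<longleftrightarrow> ?h i = 1) \<and> ?h i \<in> {1..Suc (l + m)}"
    if i: "1 \<le> i" "i \<le> Suc (l + m)" for i
    using i
  proof (cases rule: index_cases)
    case left
    then show ?thesis using i fr[of i] by (simp add: glue_simps)
  next
    case min
    then show ?thesis by (simp add: glue_simps)
  next
    case (right j)
    then show ?thesis using gr[of j] by (simp add: glue_simps)
  qed
  show "inj_on ?h {1..Suc (l + m)}"
  proof (rule inj_onI)
    fix i j
    assume ij: "i \<in> {1..Suc (l + m)}" "j \<in> {1..Suc (l + m)}" and eq: "?h i = ?h j"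
    from ij have i: "1 \<le> i" "i \<le> Suc (l + m)" and j: "1 \<le> j" "j \<le> Suc (l + m)" by auto
    have same: "i \<le> l \<longleftrightarrow> j \<le> l" "i = Suc l \<longleftrightarrow> j = Suc l"
      using pos[OF i] pos[OF j] eq by auto
    from i show "i = j"
    proof (cases rule: index_cases)
      case left
      then show ?thesis using same i j eq by (simp add: glue_simps fi)
    next
      case min
      then show ?thesis using same by simp
    next
      case (right i')
      from j show ?thesis
      proof (cases rule: index_cases)
        case (right j')
        then show ?thesis
          using \<open>i = Suc (l + i')\<close> \<open>1 \<le> i'\<close> \<open>i' \<le> m\<close> eq by (simp add: glue_simps gi)
      qed (use right same in auto)
    qed
  qed
  show "?h i \<in> {1..Suc (l + m)}" if "i \<in> {1..Suc (l + m)}" for i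
    using pos[of i] that by simp
qed (auto simp: glue_simps)

text \<open>Position l + 1 carries 1, which forces l \<le> k; only then is \<open>k - l\<close> a
  true difference. Positions i in L satisfy i \<le> l \<le> k for free, and shifting R moves
  positions by l + 1 but values only by 1.\<close>

lemma glue_drop_iff:
  assumes f: "f permutes {1..l}" and g: "g permutes {1..m}"
  shows "(\<forall>i\<in>{1..Suc (l + m)}. i \<le> glue l m f g i + k) \<longleftrightarrow>
    l \<le> k \<and> (\<forall>i\<in>{1..m}. i \<le> g i + (k - l))" (is "?L \<longleftrightarrow> ?R")
proof
  assume L: ?L
  have "Suc l \<le> glue l m f g (Suc l) + k" using L by simp
  then have lk: "l \<le> k" by (simp add: glue_simps)
  moreover have "i \<le> g i + (k - l)" if "i \<in> {1..m}" for i
  proof -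
    have "Suc (l + i) \<le> glue l m f g (Suc (l + i)) + k" using L that by simp
    then show ?thesis using that lk by (simp add: glue_simps)
  qed
  ultimately show ?R by blast
next
  assume R: ?R
  show ?L
  proof
    fix i assume "i \<in> {1..Suc (l + m)}"
    then have i: "1 \<le> i" "i \<le> Suc (l + m)" by auto
    then show "i \<le> glue l m f g i + k"
    proof (cases rule: index_cases)
      case left
      then show ?thesis using R i by (simp add: glue_simps)
    next
      case min
      then show ?thesis using R by (simp add: glue_simps)
    next
      case (right j)
      then have "j \<le> g j + (k - l)" using R by auto
      then show ?thesis using R right by (simp add: glue_simps)
    qed
  qed
qed

text \<open>For the converse, locate the first position of a supposed 213. If it is in L, the larger
  third entry must be in L too, hence all three are; at the entry 1 nothing is smaller; in R, all
  three positions are in R.\<close>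

lemma avoids213_glue_iff:
  assumes f: "f permutes {1..l}" and g: "g permutes {1..m}"
  shows "avoids213 (Suc (l + m)) (glue l m f g) \<longleftrightarrow> avoids213 l f \<and> avoids213 m g"
    (is "?L \<longleftrightarrow> ?R")
proof
  let ?h = "glue l m f g"
  note fr = permutes_range[OF f] and gr = permutes_range[OF g]
  {
    assume L: ?L
    have "avoids213 l f"
      unfolding avoids213_def
    proof safe
      fix a b c assume "1 \<le> a" "a < b" "b < c" "c \<le> l" "f b < f a" "f a < f c"
      then have "1 \<le> a \<and> a < b \<and> b < c \<and> c \<le> Suc (l + m) \<and> ?h b < ?h a \<and> ?h a < ?h c"
        by (simp add: glue_simps)
      then show False using L unfolding avoids213_def by blast
    qed
    moreover have "avoids213 m g"
      unfolding avoids213_def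
    proof safe
      fix a b c assume "1 \<le> a" "a < b" "b < c" "c \<le> m" "g b < g a" "g a < g c"
      then have "1 \<le> Suc (l + a) \<and> Suc (l + a) < Suc (l + b) \<and> Suc (l + b) < Suc (l + c)
        \<and> Suc (l + c) \<le> Suc (l + m) \<and> ?h (Suc (l + b)) < ?h (Suc (l + a))
        \<and> ?h (Suc (l + a)) < ?h (Suc (l + c))"
        by (simp add: glue_simps)
      then show False using L unfolding avoids213_def by blast
    qed
    ultimately show ?R by blast
  }
  assume R: ?R
  have pos: "1 \<le> ?h i" if "1 \<le> i" "i \<le> Suc (l + m)" for i
    using permutes_range(1)[OF permutes_glue[OF f g]] that by blast
  show ?L
    unfolding avoids213_def
  proof safe
    fix a b c assume abc: "1 \<le> a" "a < b" "b < c" "c \<le> Suc (l + m)" "?h b < ?h a" "?h a < ?h c"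
    then have "1 \<le> a" "a \<le> Suc (l + m)" by auto
    then show False
    proof (cases rule: index_cases)
      case left
      have c: "1 \<le> c" "c \<le> Suc (l + m)" using abc by auto
      then have "c \<le> l"
      proof (cases rule: index_cases)
        case (right j)
        then show ?thesis using abc left fr[of a] gr[of j] by (simp add: glue_simps)
      qed (use abc left in \<open>simp_all add: glue_simps\<close>)
      then have "f b < f a" "f a < f c" using abc by (simp_all add: glue_simps)
      with abc \<open>c \<le> l\<close> R show False unfolding avoids213_def by blast
    next
      case min
      then show False using abc pos[of b] by (simp add: glue_simps)
    next
      case (right a')
      define b' c' where "b' = b - Suc l" and "c' = c - Suc l"
      have "b = Suc (l + b')" "c = Suc (l + c')" using abc right by (auto simp: b'_def c'_def)
      with abc right have "1 \<le> a' \<and> a' < b' \<and> b' < c' \<and> c' \<le> m \<and> g b' < g a' \<and> g a' < g c'"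
        by (simp add: glue_simps)
      with R show False unfolding avoids213_def by blast
    qed
  qed
qed

text \<open>The step from the last entry of L into 1 is a descent, present iff L is nonempty; the
  step from 1 into R is an ascent. All other descents are those of L, or those of R moved by l +
  1.\<close>

lemma des_glue:
  assumes f: "f permutes {1..l}" and g: "g permutes {1..m}"
  shows "des (Suc (l + m)) (glue l m f g) = (if l = 0 then 0 else 1) + des l f + des m g"
proof -
  let ?h = "glue l m f g"
  let ?F = "{i. 1 \<le> i \<and> i < l \<and> f i > f (i + 1)}"
  let ?G = "{i. 1 \<le> i \<and> i < m \<and> g i > g (i + 1)}"
  let ?M = "if l = 0 then {} else {l}"
  let ?shift = "\<lambda>i. Suc (l + i)"
  note fr = permutes_range[OF f] and gr = permutes_range[OF g]
  have fin: "finite ?F" "finite ?G" by auto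
  have "{i. 1 \<le> i \<and> i < Suc (l + m) \<and> ?h i > ?h (i + 1)} = ?M \<union> (?F \<union> ?shift ` ?G)"
  proof (rule set_eqI)
    fix i
    consider "i = 0" | "1 \<le> i" "i < l" | "1 \<le> i" "i = l" | "i = Suc l" | j where "1 \<le> j" "i = Suc (l + j)"
      using that(5)[of "i - Suc l"] by fastforce
    then show "i \<in> {i. 1 \<le> i \<and> i < Suc (l + m) \<and> ?h i > ?h (i + 1)} \<longleftrightarrow>
        i \<in> ?M \<union> (?F \<union> ?shift ` ?G)"
    proof cases
      case 1
      then show ?thesis by auto
    next
      case 2
      then show ?thesis by (auto simp: glue_simps)
    next
      case 3
      then show ?thesis using fr[of l] by (auto simp: glue_simps)
    next
      case 4
      then show ?thesis
        using glue_simps(3)[of 1 m l f g] by (auto simp: glue_simps)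
    next
      case (5 j)
      have "?h (Suc (Suc (l + j))) = Suc (g (Suc j))" if "j < m"
        using glue_simps(3)[of "Suc j" m l f g] that by simp
      moreover have "?h (Suc (l + j)) = Suc (g j)" if "j \<le> m"
        using glue_simps(3)[of j m l f g] 5 that by simp
      ultimately show ?thesis using 5 by (auto simp: image_iff)
    qed
  qed
  then have "des (Suc (l + m)) ?h = card (?M \<union> (?F \<union> ?shift ` ?G))"
    by (simp only: des_def)
  also have "\<dots> = card ?M + card (?F \<union> ?shift ` ?G)"
    using fin by (intro card_Un_disjoint) auto
  also have "card (?F \<union> ?shift ` ?G) = card ?F + card (?shift ` ?G)"
    using fin by (intro card_Un_disjoint) auto
  also have "card (?shift ` ?G) = card ?G"
    by (rule card_image) (simp add: inj_on_def)
  finally show ?thesis by (simp add: des_def)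
qed

section \<open>Recovering the blocks\<close>

lemma glue_exhaust:
  assumes \<pi>: "\<pi> permutes {1..Suc (l + m)}" and av: "avoids213 (Suc (l + m)) \<pi>"
    and min: "\<pi> (Suc l) = 1"
  obtains f g where "f permutes {1..l}" "g permutes {1..m}" "\<pi> = glue l m f g"
proof -
  let ?n = "Suc (l + m)"
  note r = permutes_range[OF \<pi>]
  have inj: "\<pi> i = \<pi> j \<longleftrightarrow> i = j" for i j using permutes_inj[OF \<pi>] by (simp add: inj_eq)
  have card_im: "card (\<pi> ` S) = card S" for S
    by (rule card_image) (simp add: inj_on_def inj)
  \<comment> \<open>Otherwise the positions a, l + 1, c would form a 213 with the entry 1 in the
    middle.\<close>
  have desc: "\<pi> c < \<pi> a" if "1 \<le> a" "a \<le> l" "Suc l \<le> c" "c \<le> ?n" for a c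
  proof (cases "c = Suc l")
    case True
    then show ?thesis using min that r[of a] inj[of a c] by auto
  next
    case False
    have "\<pi> (Suc l) < \<pi> a" using min that r[of a] inj[of a "Suc l"] by auto
    moreover have "a < Suc l" "Suc l < c" using that False by auto
    ultimately have "\<not> \<pi> a < \<pi> c"
      using av that(1,4) unfolding avoids213_def by blast
    then show ?thesis using that inj[of a c] by auto
  qed
  \<comment> \<open>Counting turns the comparison into exact ranges: m + 1 entries lie below each
    entry of L, and (in \<open>right\<close>) l entries lie above each later one.\<close>
  have left: "Suc m < \<pi> a" if "1 \<le> a" "a \<le> l" for a
  proof -
    have "\<pi> ` {Suc l..?n} \<subseteq> {1..<\<pi> a}"
      using desc[OF that] r by fastforce
    then have "card (\<pi> ` {Suc l..?n}) \<le> card {1..<\<pi> a}" by (rule card_mono[rotated]) simp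
    then have "Suc m \<le> \<pi> a - 1" by (simp add: card_im)
    then show ?thesis by linarith
  qed
  have right: "\<pi> c \<le> Suc m" if "Suc l \<le> c" "c \<le> ?n" for c
  proof -
    have "\<pi> ` {1..l} \<subseteq> {Suc (\<pi> c)..?n}"
      using desc[OF _ _ that] r by fastforce
    then have "card (\<pi> ` {1..l}) \<le> card {Suc (\<pi> c)..?n}" by (rule card_mono[rotated]) simp
    then have "l \<le> ?n - \<pi> c" by (simp add: card_im)
    moreover have "\<pi> c \<le> ?n" using r that by auto
    ultimately show ?thesis by linarith
  qed
  have right': "1 < \<pi> c" if "Suc l < c" "c \<le> ?n" for c
    using r[of c] that min inj[of c "Suc l"] by fastforce
  \<comment> \<open>The bounds \<open>left\<close> and \<open>right'\<close> keep the subtractions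
    in \<open>f\<close> and \<open>g\<close> from truncating.\<close>
  define f where "f = (\<lambda>i. if i \<in> {1..l} then \<pi> i - Suc m else i)"
  define g where "g = (\<lambda>i. if i \<in> {1..m} then \<pi> (Suc (l + i)) - 1 else i)"
  have f_eq: "\<pi> i = f i + Suc m" if "1 \<le> i" "i \<le> l" for i
    using left[OF that] that by (simp add: f_def)
  have g_eq: "\<pi> (Suc (l + i)) = Suc (g i)" if "1 \<le> i" "i \<le> m" for i
    using right'[of "Suc (l + i)"] that by (simp add: g_def)
  have f: "f permutes {1..l}"
  proof (rule permutesI_inj_on)
    show "inj_on f {1..l}"
    proof (rule inj_onI)
      fix i j assume "i \<in> {1..l}" "j \<in> {1..l}" "f i = f j"
      then show "i = j" using f_eq[of i] f_eq[of j] inj[of i j] by simp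
    qed
    show "f i \<in> {1..l}" if "i \<in> {1..l}" for i
      using that f_eq[of i] left[of i] r(2)[of i] by auto
  qed (auto simp: f_def)
  have g: "g permutes {1..m}"
  proof (rule permutesI_inj_on)
    show "inj_on g {1..m}"
    proof (rule inj_onI)
      fix i j assume "i \<in> {1..m}" "j \<in> {1..m}" "g i = g j"
      then show "i = j" using g_eq[of i] g_eq[of j] inj[of "Suc (l + i)" "Suc (l + j)"] by simp
    qed
    show "g i \<in> {1..m}" if "i \<in> {1..m}" for i
      using that g_eq[of i] right[of "Suc (l + i)"] right'[of "Suc (l + i)"] by auto
  qed (auto simp: g_def)
  have "\<pi> i = glue l m f g i" for i
  proof (cases "1 \<le> i \<and> i \<le> ?n")
    case True
    then have i: "1 \<le> i" "i \<le> ?n" by auto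
    then show ?thesis
      by (cases rule: index_cases) (use i f_eq g_eq min in \<open>simp_all add: glue_simps\<close>)
  next
    case False
    then have "\<pi> i = i" using permutes_not_in[OF \<pi>, of i] by auto
    then show ?thesis using False by (simp add: glue_simps not_le Suc_le_eq)
  qed
  then show thesis using that f g by blast
qed

text \<open>The index l is one less than the position of the entry 1: l \<le> n leaves room for R,
  and l \<le> k bounds the drop of 1.\<close>

lemma bij_betw_glue:
  "bij_betw (\<lambda>(l, f, g). glue l (n - l) f g)
     (SIGMA l:{..min n k}. A213 l l \<times> A213 (n - l) (k - l)) (A213 (Suc n) k)"
  (is "bij_betw ?h ?S _")
proof (rule bij_betw_imageI)
  have perm: "f permutes {1..l}" "g permutes {1..n - l}" "l \<le> n" "l \<le> k"
    if "(l, f, g) \<in> ?S" for l f g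
    using that by (auto simp: A213_def mem_A_iff)
  show "inj_on ?h ?S"
  proof (rule inj_onI)
    fix x y
    assume xy: "x \<in> ?S" "y \<in> ?S" "?h x = ?h y"
    obtain l f g l' f' g' where x: "x = (l, f, g)" and y: "y = (l', f', g')"
      by (metis prod.exhaust)
    have S: "(l, f, g) \<in> ?S" "(l', f', g') \<in> ?S" using xy(1,2) by (simp_all only: x y)
    have eq: "glue l (n - l) f g = glue l' (n - l') f' g'" using xy(3) by (simp add: x y)
    note P = perm[OF S(1)] and P' = perm[OF S(2)]
    \<comment> \<open>Both sides are 1, so the position of 1 determines l.\<close>
    have "glue l (n - l) f g (Suc l) = glue l (n - l) f g (Suc l')"
      using glue_simps(2) eq by metis
    then have l: "l' = l"
      using permutes_inj[OF permutes_glue[OF P(1,2)]] by (simp add: inj_eq)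
    have "f i = f' i" for i
    proof (cases "i \<in> {1..l}")
      case True
      then show ?thesis using fun_cong[OF eq, of i] l by (simp add: glue_simps)
    next
      case False
      then show ?thesis
        using permutes_not_in[OF P(1) False] permutes_not_in[OF P'(1)] l by simp
    qed
    moreover have "g i = g' i" for i
    proof (cases "i \<in> {1..n - l}")
      case True
      then show ?thesis using fun_cong[OF eq, of "Suc (l + i)"] l by (simp add: glue_simps)
    next
      case False
      then show ?thesis
        using permutes_not_in[OF P(2) False] permutes_not_in[OF P'(2)] l by simp
    qed
    ultimately show "x = y" using l by (auto simp: x y)
  qed
  have glue_mem: "glue l (n - l) f g \<in> A213 (Suc n) k \<longleftrightarrow>
      l \<le> k \<and> f \<in> A213 l l \<and> g \<in> A213 (n - l) (k - l)"
    if "l \<le> n" and f: "f permutes {1..l}" and g: "g permutes {1..n - l}" for l f g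
    using that permutes_glue[OF f g] glue_drop_iff[OF f g] avoids213_glue_iff[OF f g]
    by (auto simp: A213_def mem_A_iff)
  show "?h ` ?S = A213 (Suc n) k"
  proof (intro equalityI subsetI)
    fix \<pi> assume "\<pi> \<in> ?h ` ?S"
    then obtain l f g where S: "(l, f, g) \<in> ?S" and \<pi>: "\<pi> = glue l (n - l) f g" by auto
    show "\<pi> \<in> A213 (Suc n) k"
      unfolding \<pi> using glue_mem perm[OF S] S by auto
  next
    fix \<pi> assume \<pi>: "\<pi> \<in> A213 (Suc n) k"
    then have p: "\<pi> permutes {1..Suc n}" and av: "avoids213 (Suc n) \<pi>"
      by (auto simp: A213_def mem_A_iff)
    have "1 \<in> \<pi> ` {1..Suc n}" using permutes_image[OF p] by simp
    then obtain i where "i \<in> {1..Suc n}" "\<pi> i = 1" by (metis imageE)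
    then obtain l where l: "l \<le> n" "\<pi> (Suc l) = 1" by (cases i) auto
    then have n: "Suc n = Suc (l + (n - l))" by simp
    obtain f g where fg: "f permutes {1..l}" "g permutes {1..n - l}" "\<pi> = glue l (n - l) f g"
      using glue_exhaust[of \<pi> l "n - l"] p av l n by metis
    then have "(l, f, g) \<in> ?S" using glue_mem[OF l(1) fg(1,2)] \<pi> l(1) by auto
    then show "\<pi> \<in> ?h ` ?S" using fg(3) by force
  qed
qed

section \<open>Generating functions\<close>

text \<open>For k \<ge> n this is the Narayana polynomial in \<open>x\<close>.\<close>

definition des_sum :: "'a::comm_semiring_1 \<Rightarrow> nat \<Rightarrow> nat \<Rightarrow> 'a" where
  "des_sum x n k = (\<Sum>\<pi>\<in>A213 n k. x ^ des n \<pi>)"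

lemma des_sum_0: "des_sum x 0 k = 1"
  by (simp add: des_sum_def A213_0 des_def)

lemma des_sum_eq_of_le: "n \<le> k \<Longrightarrow> des_sum x n k = des_sum x n n"
  unfolding des_sum_def A213_def by (drule A_eq_of_le) (simp only:)

text \<open>Sum along \<open>bij_betw_glue\<close>: by \<open>des_glue\<close> the weight is
  multiplicative, with a factor \<open>x\<close> for the descent into 1, missing when L is
  empty.\<close>

lemma des_sum_Suc:
  "des_sum x (Suc n) k =
    (\<Sum>l\<le>min n k. (if l = 0 then 1 else x) * des_sum x l l * des_sum x (n - l) (k - l))"
proof -
  let ?S = "SIGMA l:{..min n k}. A213 l l \<times> A213 (n - l) (k - l)"
  have "des_sum x (Suc n) k = (\<Sum>(l, f, g)\<in>?S. x ^ des (Suc n) (glue l (n - l) f g))"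
    unfolding des_sum_def
    by (subst sum.reindex_bij_betw[OF bij_betw_glue, symmetric]) (simp add: case_prod_unfold)
  also have "\<dots> = (\<Sum>(l, f, g)\<in>?S. (if l = 0 then 1 else x) * (x ^ des l f * x ^ des (n - l) g))"
  proof (rule sum.cong[OF refl])
    fix t assume "t \<in> ?S"
    then obtain l f g where t: "t = (l, f, g)"
      and "l \<in> {..min n k}" "f \<in> A213 l l" "g \<in> A213 (n - l) (k - l)"
      by auto
    then have "f permutes {1..l}" "g permutes {1..n - l}" "l \<le> n"
      by (auto simp: A213_def mem_A_iff)
    then show "(case t of (l, f, g) \<Rightarrow> x ^ des (Suc n) (glue l (n - l) f g)) =
        (case t of (l, f, g) \<Rightarrow> (if l = 0 then 1 else x) * (x ^ des l f * x ^ des (n - l) g))"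
      using des_glue[of f l g "n - l"] by (simp add: t power_add mult.assoc)
  qed
  also have "\<dots> = (\<Sum>l\<le>min n k. \<Sum>(f, g)\<in>A213 l l \<times> A213 (n - l) (k - l).
      (if l = 0 then 1 else x) * (x ^ des l f * x ^ des (n - l) g))"
    by (subst sum.Sigma) (auto simp: finite_A213 case_prod_unfold)
  also have "\<dots> = (\<Sum>l\<le>min n k. (if l = 0 then 1 else x) *
      (des_sum x l l * des_sum x (n - l) (k - l)))"
    unfolding des_sum_def sum_product sum.cartesian_product
    by (simp only: sum_distrib_left case_prod_unfold)
  finally show ?thesis by (simp add: mult.assoc)
qed

section \<open>Functional equations\<close>

text \<open>The part of \<open>G\<close> with k = n, where the drop bound is void.\<close>

definition C_series :: series where
  "C_series = Abs_fps (\<lambda>n. des_sum (fps_const fps_X) n n * fps_X ^ n)"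

text \<open>The weight of the block L: nonempty L pays p for the descent into 1, and its q^l is the
  share of q^k in the splitting k = l + (k - l).\<close>

definition N_series :: series where
  "N_series = 1 + pvar * (C_series - 1)"

lemma C_series_nth: "fps_nth C_series n = des_sum (fps_const fps_X) n n * fps_X ^ n"
  by (simp add: C_series_def)

lemma N_series_nth: "fps_nth N_series n =
    (if n = 0 then 1 else fps_const fps_X) * des_sum (fps_const fps_X) n n * fps_X ^ n"
  by (simp add: N_series_def C_series_nth pvar_def des_sum_0 mult.assoc)

text \<open>The recurrence at k = n = m + 1. Splitting n as 1 + l + (m - l) distributes q^n over the
  factor q, \<open>N_series\<close> and \<open>C_series\<close>.\<close>

lemma C_series_eq: "C_series = 1 + zvar * qvar * N_series * C_series"
proof (rule fps_ext)
  fix n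
  let ?P = "fps_const fps_X :: rat fps fps"
  show "fps_nth C_series n = fps_nth (1 + zvar * qvar * N_series * C_series) n"
  proof (cases n)
    case 0
    then show ?thesis by (simp add: C_series_nth des_sum_0 zvar_def mult.assoc)
  next
    case (Suc m)
    have "fps_nth (zvar * qvar * N_series * C_series) n =
        fps_X * (\<Sum>l=0..m. fps_nth N_series l * fps_nth C_series (m - l))"
      by (simp add: Suc zvar_def qvar_def mult.assoc fps_mult_nth[of N_series])
    also have "\<dots> = (\<Sum>l\<le>m. (if l = 0 then 1 else ?P) * des_sum ?P l l
        * des_sum ?P (m - l) (m - l) * fps_X ^ Suc m)"
      unfolding sum_distrib_left atLeast0AtMost
    proof (intro sum.cong refl)
      fix l assume "l \<in> {..m}"
      then have "fps_X ^ Suc m = (fps_X * fps_X ^ l * fps_X ^ (m - l) :: rat fps fps)"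
        by (simp flip: power_add add: mult.assoc)
      then show "fps_X * (fps_nth N_series l * fps_nth C_series (m - l)) =
          (if l = 0 then 1 else ?P) * des_sum ?P l l * des_sum ?P (m - l) (m - l) * fps_X ^ Suc m"
        by (simp only: N_series_nth C_series_nth mult_ac)
    qed
    \<comment> \<open>The recurrence bounds R, of length m - l, by m + 1 - l; this exceeds the
      length, so it may be lowered to m - l.\<close>
    also have "\<dots> = des_sum ?P n n * fps_X ^ n"
      by (simp add: Suc des_sum_Suc sum_distrib_right des_sum_eq_of_le[of "m - _" "Suc m - _"])
    finally show ?thesis by (simp add: Suc C_series_nth)
  qed
qed

lemma G_nth: "fps_nth G n = (\<Sum>k\<le>n. des_sum (fps_const fps_X) n k * fps_X ^ k)"
  by (simp add: G_def des_sum_def sum_distrib_right atLeast0AtMost)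

lemma sum_shift_atMost:
  fixes u :: "nat \<Rightarrow> 'a::comm_monoid_add"
  assumes "l \<le> n"
  shows "sum u {l..n} = (\<Sum>j\<le>n - l. u (l + j))"
  using assms
  by (intro sum.reindex_bij_witness[of _ "\<lambda>j. l + j" "\<lambda>k. k - l"]) auto

text \<open>Truncating at \<open>k \<le> n\<close> is not preserved by the splitting: for \<open>R\<close> of length \<open>m - l\<close> the
  bound \<open>k - l\<close> ranges up to \<open>m - l + 1\<close>. The extra top term produces the summand \<open>qvar * C_series\<close>.\<close>

lemma G_eq_aux: "G = 1 + zvar * N_series * (G + qvar * C_series)"
proof (rule fps_ext)
  fix n
  let ?P = "fps_const fps_X :: rat fps fps"
  let ?w = "\<lambda>l. (if l = 0 then 1 else ?P) * des_sum ?P l l"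
  show "fps_nth G n = fps_nth (1 + zvar * N_series * (G + qvar * C_series)) n"
  proof (cases n)
    case 0
    then show ?thesis by (simp add: G_nth des_sum_0 zvar_def mult.assoc)
  next
    case (Suc m)
    have inner: "fps_nth (G + qvar * C_series) j =
        (\<Sum>k\<le>Suc j. des_sum ?P j k * fps_X ^ k)" for j
      using des_sum_eq_of_le[of j "Suc j" ?P]
      by (simp add: G_nth qvar_def C_series_nth mult_ac)
    have "fps_nth G n = (\<Sum>k\<le>Suc m. \<Sum>l\<le>min m k.
        ?w l * des_sum ?P (m - l) (k - l) * fps_X ^ k)"
      by (simp add: Suc G_nth des_sum_Suc sum_distrib_right)
    \<comment> \<open>Exchange of summation: l \<le> m already follows from l \<le>
      \<open>min m k\<close>, so only l \<le> k restricts k from below.\<close>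
    also have "\<dots> = (\<Sum>l\<le>m. \<Sum>k=l..Suc m. ?w l * des_sum ?P (m - l) (k - l) * fps_X ^ k)"
      unfolding sum.Sigma[OF finite_atMost ballI[OF finite_atMost]]
        sum.Sigma[OF finite_atMost ballI[OF finite_atLeastAtMost]]
      by (rule sum.reindex_bij_witness[of _ "\<lambda>(l, k). (k, l)" "\<lambda>(k, l). (l, k)"]) auto
    also have "\<dots> = (\<Sum>l\<le>m. fps_nth N_series l * fps_nth (G + qvar * C_series) (m - l))"
    proof (intro sum.cong refl)
      fix l assume "l \<in> {..m}"
      then have "l \<le> m" by simp
      then have "(\<Sum>k=l..Suc m. ?w l * des_sum ?P (m - l) (k - l) * fps_X ^ k) =
          (\<Sum>j\<le>Suc (m - l). ?w l * des_sum ?P (m - l) j * fps_X ^ (l + j))"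
        by (simp only: sum_shift_atMost le_SucI Suc_diff_le add_diff_cancel_left')
      also have "\<dots> = fps_nth N_series l * fps_nth (G + qvar * C_series) (m - l)"
        unfolding inner N_series_nth sum_distrib_left
        by (intro sum.cong refl) (simp only: power_add mult_ac)
      finally show "(\<Sum>k=l..Suc m. ?w l * des_sum ?P (m - l) (k - l) * fps_X ^ k) =
          fps_nth N_series l * fps_nth (G + qvar * C_series) (m - l)" .
    qed
    also have "\<dots> = fps_nth (zvar * N_series * (G + qvar * C_series)) n"
      by (simp add: Suc zvar_def mult.assoc fps_mult_nth[of N_series] atLeast0AtMost
          del: fps_add_nth)
    finally show ?thesis by (simp add: Suc)
  qed
qed

text \<open>By \<open>C_series_eq\<close>, the extra summand together with 1 is again
  \<open>C_series\<close>.\<close>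

lemma G_eq: "G = C_series + zvar * N_series * G"
proof -
  have "G = (1 + zvar * qvar * N_series * C_series) + zvar * N_series * G"
    using G_eq_aux by (simp add: algebra_simps)
  then show ?thesis by (simp only: C_series_eq[symmetric])
qed

section \<open>The square root and \<open>F0\<close>\<close>

text \<open>With t = qz, x = C - 1 solves p t x^2 - (1 - t(1 + p)) x + t = 0, whose discriminant is
  the radicand. Constant term 1 selects the root of the radicand.\<close>

lemma sqrt_series_discriminant:
  "sqrt_series ((1 + zvar * qvar * (1 - pvar))\<^sup>2 - 4 * zvar * qvar) =
    1 - zvar * qvar * (1 + pvar) - 2 * pvar * qvar * zvar * (C_series - 1)"
  (is "sqrt_series ?f = ?s")
  unfolding sqrt_series_def
proof (rule the1_equality[OF sqrt_series_ex1 conjI])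
  show "fps_nth ?f 0 = 1"
    by (simp add: power2_eq_square zvar_def mult.assoc)
  show "fps_nth (fps_nth (fps_nth ?s 0) 0) 0 = 1"
    by (simp add: zvar_def mult.left_commute[of _ fps_X] mult.assoc)
  have "C_series = 1 + zvar * qvar * (1 + pvar * (C_series - 1)) * C_series"
    using C_series_eq by (simp only: N_series_def)
  \<comment> \<open>The difference of the two sides is 4pqz times the quadratic above.\<close>
  then show "?s\<^sup>2 = ?f" by algebra
qed

text \<open>The known square root turns the numerator into 2pqz(C - 1), and the nonzero factor 2pqz
  cancels in the fraction field.\<close>

lemma F0_eq: "F0 = to_fract (C_series - 1)"
proof -
  have nz: "2 * pvar * qvar * zvar \<noteq> 0"
    by (simp add: pvar_def qvar_def zvar_def)
  have cancel: "to_fract (d * x) / to_fract d = to_fract x" if "d \<noteq> 0" for d x :: series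
    using that by simp
  have [simp]: "to_fract (2 :: series) = 2"
    by (metis one_add_one to_fract_1 to_fract_add)
  have "F0 = to_fract (2 * pvar * qvar * zvar * (C_series - 1)) /
      to_fract (2 * pvar * qvar * zvar)"
    unfolding F0_def sqrt_series_discriminant Let_def
    by simp
  also have "\<dots> = to_fract (C_series - 1)"
    using nz by (rule cancel)
  finally show ?thesis .
qed

section \<open>Solving for \<open>G\<close>\<close>

theorem theorem1p4:
  fixes p q z :: "series fract"
  assumes "p = to_fract pvar" and "q = to_fract qvar" and "z = to_fract zvar"
  shows "to_fract G =
    (1 - p * q * z - (1 - z) * q + (z * q - p * q * z - q) * F0) /
    (1 - z - p * q * z - (1 - z) * q)"
proof -
  let ?D = "1 - zvar - pvar * qvar * zvar - (1 - zvar) * qvar"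
  let ?M = "1 - pvar * qvar * zvar - (1 - zvar) * qvar
    + (zvar * qvar - pvar * qvar * zvar - qvar) * (C_series - 1)"
  have "fps_nth (1 - zvar * N_series) 0 = 1" by (simp add: zvar_def)
  then have unit: "1 - zvar * N_series \<noteq> 0" by force
  \<comment> \<open>At z = 0 the denominator is 1 - q, which is 1 at q = 0.\<close>
  have "fps_nth (fps_nth ?D 0) 0 = 1" by (simp add: zvar_def qvar_def mult.assoc)
  then have "?D \<noteq> 0" by force
  then have D: "to_fract ?D \<noteq> 0" by (simp only: to_fract_eq_0_iff not_False_eq_True)
  have C: "C_series = 1 + zvar * qvar * (1 + pvar * (C_series - 1)) * C_series"
    using C_series_eq by (simp only: N_series_def)
  have G: "G = C_series + zvar * (1 + pvar * (C_series - 1)) * G"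
    using G_eq by (simp only: N_series_def)
  \<comment> \<open>Since (1 - zN)G = C, this amounts to C * \<open>?D\<close> = (1 - zN) *
    \<open>?M\<close>, which follows from the quadratic equation for C; then 1 - zN is
    cancelled.\<close>
  have "(1 - zvar * N_series) * (G * ?D) = (1 - zvar * N_series) * ?M"
    unfolding N_series_def using C G by algebra
  then have "G * ?D = ?M" by (rule mult_left_cancel[OF unit, THEN iffD1])
  then have "to_fract G * to_fract ?D = to_fract ?M" by (simp only: flip: to_fract_mult)
  then have "to_fract G = to_fract ?M / to_fract ?D" using D by (simp add: eq_divide_eq)
  then show ?thesis
    by (simp add: assms F0_eq)
qed

end
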